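(* Let $L>0$. There is a constant $\alpha_0>0$ depending only on $L$ such that the following holds. Let $f:\mathbb{R}^d\to\mathbb{R}$ be $C^2$ with $|\nabla^2f(w)|\le L$ for all $w\in\mathbb{R}^d$, let $\{\alpha_m\}_{m\ge1}$ be a nonincreasing sequence with $0\le\alpha_m\le\alpha_0$ for all $m$, and let $\{w_m\}_{m\ge1}$ be any solution of the gradient descent iteration $$w_{m+1}=w_m-\alpha_m\nabla f(w_m),\qquad m\ge1,$$ with $\nabla f(w_1)\ne0$. Then the condition $\sum_m\alpha_m=\infty$ is necessary in order that $|\nabla f(w_m)|\to0$: that is, if $|\nabla f(w_m)|\to0$ as $m\to\infty$, then $\sum_{m=1}^\infty\alpha_m=\infty$.
   Context: $|\cdot|$ is the Euclidean norm on vectors and the operator norm on matrices. *)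

theory Defs
  imports "HOL-Analysis.Analysis"
begin

text \<open>
  The constant in the theorem must not depend on the dimension \<open>d\<close>, so \<open>d\<close> is quantified inside
  the existential over that constant and cannot be a type. Points of \<open>R^d\<close> are therefore
  functions \<^typ>\<open>nat \<Rightarrow> real\<close> that vanish from index \<open>d\<close> on (coordinates are numbered
  \<open>0, \<dots>, d - 1\<close>). The library's topology on \<^typ>\<open>nat \<Rightarrow> real\<close> is the product topology;
  on \<open>Rn d\<close> it induces the Euclidean topology.
\<close>

definition Rn :: "nat \<Rightarrow> (nat \<Rightarrow> real) set" where
  "Rn d = {x. \<forall>i\<ge>d. x i = 0}"

definition vnorm :: "nat \<Rightarrow> (nat \<Rightarrow> real) \<Rightarrow> real" where
  "vnorm d x = L2_set x {..<d}"

definition mat_vec :: "nat \<Rightarrow> (nat \<Rightarrow> nat \<Rightarrow> real) \<Rightarrow> (nat \<Rightarrow> real) \<Rightarrow> nat \<Rightarrow> real" where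
  "mat_vec d A v = (\<lambda>i. if i < d then \<Sum>j<d. A i j * v j else 0)"

definition opnorm :: "nat \<Rightarrow> (nat \<Rightarrow> nat \<Rightarrow> real) \<Rightarrow> real" where
  "opnorm d A = (SUP v\<in>{v \<in> Rn d. vnorm d v \<le> 1}. vnorm d (mat_vec d A v))"

text \<open>
  A function \<open>R^d \<rightarrow> R\<close> is represented by a function on all of \<^typ>\<open>nat \<Rightarrow> real\<close>. Only its values on
  \<open>Rn d\<close> matter: for \<open>i < d\<close> and \<open>x \<in> Rn d\<close>, the line \<open>x(i := t)\<close> along which
  \<open>partial_deriv i f x\<close> differentiates stays in \<open>Rn d\<close>.
\<close>

definition partial_deriv :: "nat \<Rightarrow> ((nat \<Rightarrow> real) \<Rightarrow> real) \<Rightarrow> (nat \<Rightarrow> real) \<Rightarrow> real" where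
  "partial_deriv i f x = deriv (\<lambda>t. f (x(i := t))) (x i)"

text \<open>
  \<open>C_k k d f\<close>: all partial derivatives of \<open>f\<close> of order at most \<open>k\<close> exist and are continuous
  on \<open>R^d\<close>. Existence has to be demanded separately because \<^const>\<open>deriv\<close> is total.
\<close>

primrec C_k :: "nat \<Rightarrow> nat \<Rightarrow> ((nat \<Rightarrow> real) \<Rightarrow> real) \<Rightarrow> bool" where
  "C_k 0 d f \<longleftrightarrow> continuous_on (Rn d) f"
| "C_k (Suc k) d f \<longleftrightarrow> continuous_on (Rn d) f \<and>
     (\<forall>i<d. (\<forall>x\<in>Rn d. (\<lambda>t. f (x(i := t))) differentiable (at (x i))) \<and>
            C_k k d (partial_deriv i f))"

definition grad :: "nat \<Rightarrow> ((nat \<Rightarrow> real) \<Rightarrow> real) \<Rightarrow> (nat \<Rightarrow> real) \<Rightarrow> nat \<Rightarrow> real" where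
  "grad d f x = (\<lambda>i. if i < d then partial_deriv i f x else 0)"

text \<open>Entries outside the \<open>d \<times> d\<close> block are irrelevant: \<^const>\<open>opnorm\<close> does not look at them.\<close>

definition hessian :: "((nat \<Rightarrow> real) \<Rightarrow> real) \<Rightarrow> (nat \<Rightarrow> real) \<Rightarrow> nat \<Rightarrow> nat \<Rightarrow> real" where
  "hessian f x = (\<lambda>i j. partial_deriv i (partial_deriv j f) x)"

end

theory Submission imports Defs begin

text \<open>
  The bound on the Hessian makes \<open>\<nabla>f\<close> Lipschitz with constant \<open>L\<close>, hence
  \<open>|\<nabla>f(w\<^sub>m\<^sub>+\<^sub>1)| \<ge> (1 - L \<alpha>\<^sub>m) |\<nabla>f(w\<^sub>m)|\<close>. With \<open>\<alpha>\<^sub>0 = 1/(2L)\<close> the factor is at least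
  \<open>exp (-2 L \<alpha>\<^sub>m)\<close>, so that \<open>|\<nabla>f(w\<^sub>n\<^sub>+\<^sub>1)| \<ge> |\<nabla>f(w\<^sub>1)| exp (-2 L (\<alpha>\<^sub>1 + \<dots> + \<alpha>\<^sub>n))\<close>, and the left
  side can tend to \<open>0\<close> only if the sum diverges.
\<close>

section \<open>Euclidean norm and operator norm on \<open>Rn d\<close>\<close>

lemma vnorm_nonneg: "0 \<le> vnorm d x"
  by (simp add: vnorm_def)

lemma vnorm_square: "(vnorm d x)\<^sup>2 = (\<Sum>i<d. (x i)\<^sup>2)"
  by (simp add: vnorm_def L2_set_def sum_nonneg)

lemma vnorm_scale: "vnorm d (\<lambda>i. c * x i) = \<bar>c\<bar> * vnorm d x"
proof -
  have "vnorm d (\<lambda>i. c * x i) = vnorm d (\<lambda>i. \<bar>c\<bar> * x i)"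
    by (simp add: vnorm_def L2_set_def power_mult_distrib)
  then show ?thesis
    by (simp add: vnorm_def L2_set_right_distrib)
qed

lemma vnorm_triangle_diff: "vnorm d x \<le> vnorm d y + vnorm d (\<lambda>i. y i - x i)"
proof -
  have "vnorm d x \<le> vnorm d y + vnorm d (\<lambda>i. x i - y i)"
    using L2_set_triangle_ineq[of y "\<lambda>i. x i - y i" "{..<d}"] by (simp add: vnorm_def)
  also have "vnorm d (\<lambda>i. x i - y i) = vnorm d (\<lambda>i. y i - x i)"
    by (simp add: vnorm_def L2_set_def power2_commute)
  finally show ?thesis .
qed

text \<open>Membership in \<open>Rn d\<close> matters because \<open>vnorm d\<close> does not see
  the coordinates from \<open>d\<close> on.\<close>

lemma vnorm_eq_0_iff:
  assumes "x \<in> Rn d"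
  shows "vnorm d x = 0 \<longleftrightarrow> x = (\<lambda>i. 0)"
proof
  assume "vnorm d x = 0"
  then have "x i = 0" for i
    using assms by (cases "i < d") (auto simp: vnorm_def L2_set_eq_0_iff Rn_def)
  then show "x = (\<lambda>i. 0)" by auto
qed (simp add: vnorm_def L2_set_def)

lemma grad_in_Rn: "grad d f x \<in> Rn d"
  by (simp add: grad_def Rn_def)

text \<open>Cauchy-Schwarz.\<close>

lemma sum_mult_le_vnorm: "(\<Sum>i<d. x i * y i) \<le> vnorm d x * vnorm d y"
proof -
  have "(\<Sum>i<d. x i * y i) \<le> (\<Sum>i<d. \<bar>x i\<bar> * \<bar>y i\<bar>)"
    by (intro sum_mono) (simp flip: abs_mult)
  also have "\<dots> \<le> vnorm d x * vnorm d y"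
    unfolding vnorm_def by (rule L2_set_mult_ineq)
  finally show ?thesis .
qed

text \<open>The supremum in \<open>opnorm\<close> is an upper bound only if the set is bounded.
  Coordinates of a vector in the unit ball are at most 1 in absolute value, so the sum of all
  \<open>\<bar>A i j\<bar>\<close> serves as a bound.\<close>

lemma bdd_above_mat_vec:
  "bdd_above ((\<lambda>v. vnorm d (mat_vec d A v)) ` {v \<in> Rn d. vnorm d v \<le> 1})"
proof (intro bdd_aboveI2)
  fix v assume "v \<in> {v \<in> Rn d. vnorm d v \<le> 1}"
  then have v: "vnorm d v \<le> 1" by simp
  have comp: "\<bar>v j\<bar> \<le> 1" if "j < d" for j
  proof -
    have "\<bar>v j\<bar> \<le> vnorm d v"
      using member_le_L2_set[of "{..<d}" j "\<lambda>j. \<bar>v j\<bar>"] that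
      by (simp add: vnorm_def L2_set_def)
    then show ?thesis using v by simp
  qed
  have "vnorm d (mat_vec d A v) \<le> (\<Sum>i<d. \<bar>mat_vec d A v i\<bar>)"
    unfolding vnorm_def by (rule L2_set_le_sum_abs)
  also have "\<dots> \<le> (\<Sum>i<d. \<Sum>j<d. \<bar>A i j\<bar>)"
  proof (rule sum_mono)
    fix i assume "i \<in> {..<d}"
    then have "\<bar>mat_vec d A v i\<bar> \<le> (\<Sum>j<d. \<bar>A i j * v j\<bar>)"
      by (simp add: mat_vec_def)
    also have "\<dots> \<le> (\<Sum>j<d. \<bar>A i j\<bar>)"
      using comp by (intro sum_mono) (simp add: abs_mult mult_left_le)
    finally show "\<bar>mat_vec d A v i\<bar> \<le> (\<Sum>j<d. \<bar>A i j\<bar>)" .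
  qed
  finally show "vnorm d (mat_vec d A v) \<le> (\<Sum>i<d. \<Sum>j<d. \<bar>A i j\<bar>)" .
qed

text \<open>By homogeneity: a nonzero \<open>v\<close> is rescaled to norm 1, where the supremum
  applies.\<close>

lemma vnorm_mat_vec_le:
  assumes v: "v \<in> Rn d"
  shows "vnorm d (mat_vec d A v) \<le> opnorm d A * vnorm d v"
proof (cases "vnorm d v = 0")
  case True
  then have "v = (\<lambda>i. 0)" using v by (simp add: vnorm_eq_0_iff)
  then show ?thesis by (simp add: mat_vec_def vnorm_def L2_set_def)
next
  case False
  define c where "c = inverse (vnorm d v)"
  have c: "c > 0" "c * vnorm d v = 1"
    using False vnorm_nonneg[of d v] by (auto simp: c_def)
  let ?u = "\<lambda>i. c * v i"
  have "?u \<in> {v \<in> Rn d. vnorm d v \<le> 1}"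
    using v c by (simp add: Rn_def vnorm_scale)
  then have "vnorm d (mat_vec d A ?u) \<le> opnorm d A"
    unfolding opnorm_def by (intro cSUP_upper bdd_above_mat_vec)
  moreover have "mat_vec d A ?u = (\<lambda>i. c * mat_vec d A v i)"
    by (auto simp: mat_vec_def fun_eq_iff sum_distrib_left algebra_simps)
  ultimately have "c * vnorm d (mat_vec d A v) \<le> opnorm d A"
    using c by (simp add: vnorm_scale)
  then show ?thesis
    using c False vnorm_nonneg[of d v] by (simp add: c_def field_simps)
qed

section \<open>Directional derivatives of functions with continuous partial derivatives\<close>

lemma has_partial_deriv:
  assumes diff: "\<And>x. x \<in> Rn d \<Longrightarrow> (\<lambda>t. h (x(i := t))) differentiable (at (x i))"
    and "x \<in> Rn d" "i < d"
  shows "((\<lambda>t. h (x(i := t))) has_real_derivative partial_deriv i h (x(i := s))) (at s)"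
proof -
  have "x(i := s) \<in> Rn d" using assms by (simp add: Rn_def)
  from diff[OF this] show ?thesis
    by (simp add: partial_deriv_def DERIV_deriv_iff_real_differentiable)
qed

text \<open>Parametrizing the segment by \<open>r\<close> in [0, 1] treats both signs of
  \<open>a\<close>, and \<open>a = 0\<close>, at once.\<close>

lemma partial_deriv_MVT:
  assumes diff: "\<And>x. x \<in> Rn d \<Longrightarrow> (\<lambda>t. h (x(i := t))) differentiable (at (x i))"
    and "x \<in> Rn d" "i < d"
  shows "\<exists>s. \<bar>s\<bar> \<le> \<bar>a\<bar> \<and> h (x(i := x i + a)) - h x = a * partial_deriv i h (x(i := x i + s))"
proof -
  have "\<exists>r>0. r < 1 \<and> h (x(i := x i + 1 * a)) - h (x(i := x i + 0 * a))
      = (1 - 0) * (partial_deriv i h (x(i := x i + r * a)) * a)"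
  proof (rule MVT2)
    fix r
    have "((\<lambda>r. x i + r * a) has_real_derivative a) (at r)"
      by (auto intro!: derivative_eq_intros)
    with has_partial_deriv[OF assms]
    show "((\<lambda>r. h (x(i := x i + r * a))) has_real_derivative
        partial_deriv i h (x(i := x i + r * a)) * a) (at r)"
      by (rule DERIV_chain2)
  qed simp
  then obtain r where "0 < r" "r < 1"
    "h (x(i := x i + a)) - h x = a * partial_deriv i h (x(i := x i + r * a))"
    by (auto simp: mult.commute)
  then show ?thesis
    by (intro exI[of _ "r * a"]) (auto simp: abs_mult mult_left_le_one_le)
qed

text \<open>The classical argument: the increment of \<open>h\<close> telescopes over the
  coordinates, the mean value theorem handles each one, and continuity of the partial derivatives
  moves the intermediate points to the base point.\<close>

lemma directional_derivative:
  fixes h :: "(nat \<Rightarrow> real) \<Rightarrow> real"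
  assumes diff: "\<And>i x. i < d \<Longrightarrow> x \<in> Rn d \<Longrightarrow> (\<lambda>t. h (x(i := t))) differentiable (at (x i))"
    and cont: "\<And>i. i < d \<Longrightarrow> continuous_on (Rn d) (partial_deriv i h)"
    and x: "x \<in> Rn d" and v: "v \<in> Rn d"
  shows "((\<lambda>t. h (\<lambda>i. x i + t * v i)) has_real_derivative
           (\<Sum>i<d. v i * partial_deriv i h (\<lambda>i. x i + t * v i))) (at t)"
proof -
  define z where "z = (\<lambda>i. x i + t * v i)"
  have z: "z \<in> Rn d" using x v by (simp add: z_def Rn_def)
  \<comment> \<open>Move from \<open>z\<close> to \<open>z + s v\<close> one coordinate at a time.\<close>
  define y where "y k s = (\<lambda>i. if i < k then z i + s * v i else z i)" for k s
  have y: "y k s \<in> Rn d" for k s using z v by (simp add: y_def Rn_def)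
  have y0: "y 0 s = z" for s by (simp add: y_def)
  have yd: "y d s = (\<lambda>i. x i + (t + s) * v i)" for s
    using x v by (auto simp: y_def z_def Rn_def fun_eq_iff algebra_simps)
  have step: "((\<lambda>s. (h (y (Suc k) s) - h (y k s)) / s) \<longlongrightarrow> v k * partial_deriv k h z) (at 0)"
    if k: "k < d" for k
  proof -
    have "\<forall>s. \<exists>r. \<bar>r\<bar> \<le> \<bar>s * v k\<bar> \<and>
      h ((y k s)(k := y k s k + s * v k)) - h (y k s) = s * v k * partial_deriv k h ((y k s)(k := y k s k + r))"
      using partial_deriv_MVT[OF diff[OF k] y k] by blast
    moreover have "(y k s)(k := y k s k + s * v k) = y (Suc k) s" for s
      by (auto simp: y_def fun_eq_iff)
    ultimately obtain r where r: "\<And>s. \<bar>r s\<bar> \<le> \<bar>s * v k\<bar>"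
      and eq: "\<And>s. h (y (Suc k) s) - h (y k s) = s * v k * partial_deriv k h ((y k s)(k := y k s k + r s))"
      by metis
    define p where "p s = (y k s)(k := y k s k + r s)" for s
    have pR: "p s \<in> Rn d" for s using y[of k s] k by (simp add: p_def Rn_def)
    have r0: "(r \<longlongrightarrow> 0) (at 0)"
    proof (rule Lim_null_comparison)
      show "\<forall>\<^sub>F s in at 0. norm (r s) \<le> \<bar>s * v k\<bar>" using r by simp
      show "((\<lambda>s. \<bar>s * v k\<bar>) \<longlongrightarrow> 0) (at 0)" by (rule tendsto_eq_intros refl | simp)+
    qed
    have "((\<lambda>s. p s i) \<longlongrightarrow> z i) (at 0)" for i
      using r0 by (cases "i = k"; cases "i < k") (auto simp: p_def y_def intro!: tendsto_eq_intros)
    \<comment> \<open>In the product topology, coordinatewise convergence is convergence.\<close>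
    then have "(p \<longlongrightarrow> z) (at 0)"
      using limitin_componentwise[where X = "\<lambda>_. euclidean" and I = UNIV and f = p and l = z and F = "at 0"]
      by (simp add: euclidean_product_topology)
    then have "((\<lambda>s. partial_deriv k h (p s)) \<longlongrightarrow> partial_deriv k h z) (at 0)"
      by (rule continuous_on_tendsto_compose[OF cont[OF k] _ z]) (simp add: pR)
    then have "((\<lambda>s. v k * partial_deriv k h (p s)) \<longlongrightarrow> v k * partial_deriv k h z) (at 0)"
      by (intro tendsto_intros)
    then show ?thesis
    proof (rule Lim_transform_eventually)
      show "\<forall>\<^sub>F s in at 0. v k * partial_deriv k h (p s) = (h (y (Suc k) s) - h (y k s)) / s"
        by (auto simp: eventually_at_filter eq p_def)
    qed
  qed
  have "((\<lambda>s. \<Sum>k<d. (h (y (Suc k) s) - h (y k s)) / s) \<longlongrightarrow>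
      (\<Sum>k<d. v k * partial_deriv k h z)) (at 0)"
    using step by (intro tendsto_sum) auto
  moreover have "(\<Sum>k<d. (h (y (Suc k) s) - h (y k s)) / s)
      = (h (\<lambda>i. x i + (t + s) * v i) - h z) / s" for s
    using sum_lessThan_telescope[of "\<lambda>k. h (y k s)" d]
    by (simp add: sum_divide_distrib[symmetric] y0 yd)
  ultimately show ?thesis
    by (simp add: DERIV_def z_def)
qed

section \<open>Lipschitz continuity of the gradient\<close>

lemma grad_lipschitz:
  assumes C2: "C_k 2 d f" and hess: "\<And>x. x \<in> Rn d \<Longrightarrow> opnorm d (hessian f x) \<le> L"
    and x: "x \<in> Rn d" and y: "y \<in> Rn d"
  shows "vnorm d (\<lambda>i. grad d f y i - grad d f x i) \<le> L * vnorm d (\<lambda>i. y i - x i)"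
proof -
  define v where "v = (\<lambda>i. y i - x i)"
  define u where "u = (\<lambda>i. grad d f y i - grad d f x i)"
  have v: "v \<in> Rn d" using x y by (simp add: v_def Rn_def)
  have u: "u \<in> Rn d" by (simp add: u_def Rn_def grad_def)
  let ?p = "\<lambda>t i. x i + t * v i"
  have diff: "(\<lambda>t. partial_deriv j f (x(i := t))) differentiable (at (x i))"
    and cont: "continuous_on (Rn d) (partial_deriv i (partial_deriv j f))"
    if "j < d" "i < d" "x \<in> Rn d" for i j x
    using C2 that by (auto simp: numeral_2_eq_2)
  \<comment> \<open>Pairing \<open>\<nabla>f\<close> with the fixed vector \<open>u\<close> reduces the estimate to the scalar mean value theorem,
    and lets the Hessian act on \<open>u\<close>, so that its symmetry plays no role.\<close>
  have "\<exists>r>0. r < 1 \<and> (\<Sum>j<d. u j * partial_deriv j f (?p 1)) - (\<Sum>j<d. u j * partial_deriv j f (?p 0))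
      = (1 - 0) * (\<Sum>j<d. u j * (\<Sum>i<d. v i * partial_deriv i (partial_deriv j f) (?p r)))"
    by (rule MVT2) (auto intro!: DERIV_sum DERIV_cmult directional_derivative diff cont x v)
  then obtain r where eq: "(\<Sum>j<d. u j * partial_deriv j f (?p 1)) - (\<Sum>j<d. u j * partial_deriv j f (?p 0))
      = (\<Sum>j<d. u j * (\<Sum>i<d. v i * partial_deriv i (partial_deriv j f) (?p r)))"
    by auto
  have pR: "?p r \<in> Rn d" using x v by (simp add: Rn_def)
  have "(vnorm d u)\<^sup>2 = (\<Sum>j<d. u j * partial_deriv j f (?p 1)) - (\<Sum>j<d. u j * partial_deriv j f (?p 0))"
    by (simp add: vnorm_square v_def sum_subtractf[symmetric] right_diff_distrib[symmetric])
       (simp add: u_def grad_def power2_eq_square)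
  \<comment> \<open>After the sums are swapped, \<open>u\<close> is summed over the column index
    \<open>j\<close> of \<open>hessian\<close>, as in \<open>mat_vec\<close>.\<close>
  also have "\<dots> = (\<Sum>i<d. v i * mat_vec d (hessian f (?p r)) u i)"
    unfolding eq sum_distrib_left
    by (subst sum.swap) (simp add: mat_vec_def hessian_def sum_distrib_left algebra_simps)
  also have "\<dots> \<le> vnorm d v * vnorm d (mat_vec d (hessian f (?p r)) u)"
    by (rule sum_mult_le_vnorm)
  also have "\<dots> \<le> vnorm d v * (L * vnorm d u)"
    by (intro mult_left_mono order.trans[OF vnorm_mat_vec_le[OF u]] mult_right_mono hess pR vnorm_nonneg)
  finally have "vnorm d u * vnorm d u \<le> (L * vnorm d v) * vnorm d u"
    by (simp add: power2_eq_square algebra_simps)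
  \<comment> \<open>Here \<open>vnorm d u\<close> cannot be cancelled. The sign of \<open>L\<close>
    is not assumed, so nonnegativity is drawn from the Hessian bound.\<close>
  moreover have "0 \<le> L * vnorm d v" if "vnorm d u = 0"
  proof -
    have "0 \<le> vnorm d (mat_vec d (hessian f x) v)" by (rule vnorm_nonneg)
    also have "\<dots> \<le> L * vnorm d v"
      by (intro order.trans[OF vnorm_mat_vec_le[OF v]] mult_right_mono hess x vnorm_nonneg)
    finally show ?thesis .
  qed
  ultimately have "vnorm d u \<le> L * vnorm d v"
    using vnorm_nonneg[of d u] by (cases "vnorm d u = 0") (auto simp: mult_le_cancel_right)
  then show ?thesis by (simp add: u_def v_def)
qed

section \<open>Decay of the gradient along the iteration\<close>

text \<open>This is 1 - x >= exp (-2 x). It follows from exp (2 x) >= 1 + 2 x and (1 - x) (1 + 2 x)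
  = 1 + x (1 - 2 x), whose last term is nonnegative up to x = 1/2.\<close>

lemma one_le_diff_mult_exp:
  fixes x :: real
  assumes "0 \<le> x" "x \<le> 1/2"
  shows "1 \<le> (1 - x) * exp (2 * x)"
proof -
  have "0 \<le> x * (1 - 2 * x)" using assms by simp
  then have "1 \<le> (1 - x) * (1 + 2 * x)" by (simp add: algebra_simps)
  also have "\<dots> \<le> (1 - x) * exp (2 * x)"
    using assms by (intro mult_left_mono exp_ge_add_one_self) auto
  finally show ?thesis .
qed

lemma gradient_descent_lower_bound:
  fixes w :: "nat \<Rightarrow> nat \<Rightarrow> real"
  assumes "L > 0" and C2: "C_k 2 d f" and hess: "\<And>x. x \<in> Rn d \<Longrightarrow> opnorm d (hessian f x) \<le> L"
    and step: "\<And>m. m \<ge> 1 \<Longrightarrow> 0 \<le> \<alpha> m \<and> \<alpha> m \<le> 1 / (2 * L)"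
    and w: "\<And>m. m \<ge> 1 \<Longrightarrow> w m \<in> Rn d"
    and iter: "\<And>m. m \<ge> 1 \<Longrightarrow> w (m + 1) = (\<lambda>i. w m i - \<alpha> m * grad d f (w m) i)"
  shows "vnorm d (grad d f (w 1)) \<le> vnorm d (grad d f (w (n + 1))) * exp (2 * L * (\<Sum>m=1..n. \<alpha> m))"
proof (induction n)
  case 0
  show ?case by simp
next
  case (Suc n)
  let ?g = "\<lambda>m. vnorm d (grad d f (w m))"
  define m where "m = n + 1"
  have m: "m \<ge> 1" by (simp add: m_def)
  \<comment> \<open>The step bound \<open>1 / (2 * L)\<close> places \<open>a\<close> in the range
    of \<open>one_le_diff_mult_exp\<close>.\<close>
  define a where "a = L * \<alpha> m"
  have a: "0 \<le> a" "a \<le> 1/2"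
    using step[OF m] \<open>L > 0\<close> by (auto simp: a_def field_simps)
  have "vnorm d (\<lambda>i. grad d f (w (m + 1)) i - grad d f (w m) i) \<le> L * vnorm d (\<lambda>i. w (m + 1) i - w m i)"
    by (intro grad_lipschitz C2 hess w) (use m in auto)
  also have "(\<lambda>i. w (m + 1) i - w m i) = (\<lambda>i. - \<alpha> m * grad d f (w m) i)"
    unfolding iter[OF m] by simp
  also have "L * vnorm d \<dots> = a * ?g m"
    unfolding vnorm_scale using step[OF m] by (simp add: a_def)
  finally have "(1 - a) * ?g m \<le> ?g (m + 1)"
    using vnorm_triangle_diff[of d "grad d f (w m)" "grad d f (w (m + 1))"]
    by (simp add: algebra_simps)
  then have "(1 - a) * ?g m * exp (2 * a) \<le> ?g (m + 1) * exp (2 * a)"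
    by (rule mult_right_mono) simp
  moreover have "?g m * 1 \<le> ?g m * ((1 - a) * exp (2 * a))"
    by (intro mult_left_mono one_le_diff_mult_exp a vnorm_nonneg)
  moreover have "?g m * ((1 - a) * exp (2 * a)) = (1 - a) * ?g m * exp (2 * a)"
    by simp
  ultimately have "?g m \<le> ?g (m + 1) * exp (2 * a)"
    by linarith
  then have "?g m * exp (2 * L * (\<Sum>m=1..n. \<alpha> m))
      \<le> ?g (m + 1) * exp (2 * a) * exp (2 * L * (\<Sum>m=1..n. \<alpha> m))"
    by (intro mult_right_mono) auto
  also have "\<dots> = ?g (m + 1) * exp (2 * a + 2 * L * (\<Sum>m=1..n. \<alpha> m))"
    by (simp only: exp_add mult.assoc)
  also have "2 * a + 2 * L * (\<Sum>m=1..n. \<alpha> m) = 2 * L * (\<Sum>m=1..Suc n. \<alpha> m)"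
    by (simp add: a_def m_def distrib_left)
  finally show ?case using Suc by (simp add: m_def)
qed

theorem proposition2p1:
  fixes L :: real
  assumes "L > 0"
  shows "\<exists>\<alpha>\<^sub>0>0. \<forall>(d::nat) (f :: (nat \<Rightarrow> real) \<Rightarrow> real) (\<alpha> :: nat \<Rightarrow> real) (w :: nat \<Rightarrow> nat \<Rightarrow> real).
    C_k 2 d f \<longrightarrow>
    (\<forall>x\<in>Rn d. opnorm d (hessian f x) \<le> L) \<longrightarrow>
    antimono_on {1..} \<alpha> \<longrightarrow>
    (\<forall>m\<ge>1. 0 \<le> \<alpha> m \<and> \<alpha> m \<le> \<alpha>\<^sub>0) \<longrightarrow>
    (\<forall>m\<ge>1. w m \<in> Rn d) \<longrightarrow>
    (\<forall>m\<ge>1. w (m + 1) = (\<lambda>i. w m i - \<alpha> m * grad d f (w m) i)) \<longrightarrow>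
    grad d f (w 1) \<noteq> (\<lambda>i. 0) \<longrightarrow>
    (\<lambda>m. vnorm d (grad d f (w m))) \<longlonglongrightarrow> 0 \<longrightarrow>
    filterlim (\<lambda>n. \<Sum>m=1..n. \<alpha> m) at_top sequentially"
proof (intro exI[of _ "1 / (2 * L)"] conjI allI impI)
  show "1 / (2 * L) > 0" using assms by simp
next
  fix d :: nat and f :: "(nat \<Rightarrow> real) \<Rightarrow> real" and \<alpha> :: "nat \<Rightarrow> real" and w :: "nat \<Rightarrow> nat \<Rightarrow> real"
  assume C2: "C_k 2 d f"
    and hess: "\<forall>x\<in>Rn d. opnorm d (hessian f x) \<le> L"
    and step: "\<forall>m\<ge>1. 0 \<le> \<alpha> m \<and> \<alpha> m \<le> 1 / (2 * L)"
    and w: "\<forall>m\<ge>1. w m \<in> Rn d"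
    and iter: "\<forall>m\<ge>1. w (m + 1) = (\<lambda>i. w m i - \<alpha> m * grad d f (w m) i)"
    and ne: "grad d f (w 1) \<noteq> (\<lambda>i. 0)"
    and lim: "(\<lambda>m. vnorm d (grad d f (w m))) \<longlonglongrightarrow> 0"
  define c where "c = vnorm d (grad d f (w 1))"
  \<comment> \<open>The gradient lies in \<open>Rn d\<close>, so being a nonzero function gives it
    positive norm.\<close>
  have c: "c > 0"
    using ne vnorm_nonneg[of d "grad d f (w 1)"] vnorm_eq_0_iff[OF grad_in_Rn, of d f "w 1"]
    by (simp add: c_def)
  have lower: "c \<le> vnorm d (grad d f (w (n + 1))) * exp (2 * L * (\<Sum>m=1..n. \<alpha> m))" for n
    unfolding c_def using assms C2 hess step w iter
    by (intro gradient_descent_lower_bound) auto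
  show "filterlim (\<lambda>n. \<Sum>m=1..n. \<alpha> m) at_top sequentially"
    unfolding filterlim_at_top
  proof
    fix Z :: real
    \<comment> \<open>The threshold is chosen so that \<open>lower\<close> forces the partial sum
      above \<open>Z\<close>.\<close>
    have "\<forall>\<^sub>F n in sequentially. vnorm d (grad d f (w (n + 1))) < c * exp (- (2 * L * Z))"
      using LIMSEQ_ignore_initial_segment[OF lim, of 1] c by (intro order_tendstoD) auto
    then show "\<forall>\<^sub>F n in sequentially. Z \<le> (\<Sum>m=1..n. \<alpha> m)"
    proof eventually_elim
      case (elim n)
      let ?S = "\<Sum>m=1..n. \<alpha> m"
      have "c * 1 < c * exp (- (2 * L * Z)) * exp (2 * L * ?S)"
        using order.strict_trans1[OF lower[of n] mult_strict_right_mono[OF elim]] by simp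
      also have "\<dots> = c * exp (2 * L * (?S - Z))"
        by (simp only: mult.assoc exp_add[symmetric]) (simp add: right_diff_distrib)
      finally have "0 < 2 * L * (?S - Z)"
        using c by (simp add: mult_less_cancel_left_pos)
      then show ?case using assms by (simp add: zero_less_mult_iff)
    qed
  qed
qed

end
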